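(* For an instance of the dial-a-ride problem (DARP), let $Z_{LB}^{rel}$ be the objective value of an optimal solution of the LP relaxation of the location-based (LB) formulation, i.e., with $0\le\bar x_{ij}\le1$ for all $i,j\in\bar J$ instead of $\bar x_{ij}\in\{0,1\}$. Let $Z_{LAEB}^{rel}$ be the objective value of an optimal solution of the LP relaxation of the location-augmented-event-based (LAEB) formulation, i.e., with $0\le x_a\le1$ for all $a\in A$ instead of $x_a\in\{0,1\}$. (Both formulations are given in the context.) Then $$Z_{LAEB}^{rel}\ge Z_{LB}^{rel}.$$ Moreover, there are instances in which $Z_{LAEB}^{rel}>Z_{LB}^{rel}$ holds.
   Context: **DARP instance.** There are $n$ requests $R=\{1,\dots,n\}$. Request $i\in R$ has $q_i\in\mathbb{N}\setminus\{0\}$ persons, a service time $s_i\ge 0$, a maximum ride time $L_i$, a pick-up location $i^+$ and a delivery location $i^-$. Let $P=\{1^+,\dots,n^+\}$ and $D=\{1^-,\dots,n^-\}$. The depot is $0$, and $J=P\cup D\cup\{0\}$. There are $K$ identical vehicles of capacity $Q\in\mathbb{N}\setminus\{0\}$. Set $s_{i^+}=s_{i^-}=s_i$, $q_{i^+}=q_{i^-}=q_i$, $s_0=q_0=0$. Travel times $\bar t_{ij}$ and routing costs $\bar c_{ij}$ ($i,j\in J$) are non-negative and satisfy the triangle inequality. Write $\bar t_i=\bar t_{i^+i^-}$ and assume $0<\bar t_i+s_i<L_i$ for all $i\in R$. Each location $j\in J$ has a time window $[e_j,\ell_j]$, with $e_0=0$ and $\ell_0=e_0+T$ for a fixed service duration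 $T$. Assume $e_{i^+}\ge \bar t_{0i^+}$ for all $i\in R$. The depot is also represented by a start copy $0^+$ and an end copy $0^-$, both inheriting all data of $0$ (time window, service time, load, travel times, costs). Let $\bar J=P\cup D\cup\{0^+,0^-\}$. For each $i,j\in\bar J$, $\bar M_{ij}\ge \ell_i+s_i+\bar t_{ij}-e_j$ is a fixed (sufficiently large) constant, the same in both formulations. **LB formulation.** Let $\mathcal S$ be the set of all $S\subseteq\bar J$ with $0^+\in S$, $0^-\notin S$, and such that there is $i\in R$ with $i^+\notin S$ and $i^-\in S$. Let $\mathcal I_{\{j\in P\}}=1$ if $j\in P$ and $-1$ otherwise. Minimize $\sum_{i,j\in\bar J}\bar c_{ij}\bar x_{ij}$ over $(\bar x_{ij})_{i,j\in\bar J}$, $(\bar B_j)_{j\in\bar J}$, $(Q_j)_{j\in\bar J}$ subject to - $\sum_{i\in\bar J}\bar x_{ij}=1$ for all $j\in P\cup D$, and $\sum_{j\in\bar J}\bar x_{ij}=1$ for all $i\in P\cup D$; - $\sum_{j\in P}\bar x_{0^+j}\le K$; - $\sum_{i,j\in S}\bar x_{ij}\le|S|-2$ for all $S\in\mathcal S$; - $\bar B_i+s_i+\bar t_{ij}-\bar M_{ij}(1-\bar x_{ij})\le\bar B_j$ for all $i,j\in\bar J$; - $Q_i+\mathcal I_{\{j\in P\}}q_j-Q(1-\bar x_{ij})\le Q_j$ for all $i,j\in\bar J$; - $e_j\le\bar B_j\le\ell_j$ for all $j\in\bar J$; - $\max\{0,\mathcal I_{\{j\in P\}}q_j\}\le Q_j\le\min\{Q,Q+\mathcal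 I_{\{j\in P\}}q_j\}$ for all $j\in\bar J$; - $\bar B_{i^-}-\bar B_{i^+}-s_i\le L_i$ for all $i\in R$; - $\bar x_{ij}\in\{0,1\}$ for all $i,j\in\bar J$. **Event-based graph $(V,A)$.** For $i,j\in R$, $i\ne j$, let $f^1_{ij}\in\{0,1\}$ (resp. $f^2_{ij}\in\{0,1\}$) equal $1$ iff the path $j^+\to i^+\to j^-\to i^-$ (resp. $j^+\to i^+\to i^-\to j^-$) is feasible with respect to time windows and maximum ride times. Put $f^1_{i0}=f^1_{0i}=f^2_{i0}=f^2_{0i}=1$. For $i\in R$, $V_{i^+}$ is the set of $Q$-tuples $v=(v_1,\dots,v_Q)$ with: - $v_1=i^+$; - $v_l\in (R\cup\{0\})\setminus\{i\}$ and $f^1_{i,v_l}+f^2_{i,v_l}\ge1$ for $l=2,\dots,Q$; - $v_l>v_{l+1}$ or $v_{l+1}=0$ for $l=2,\dots,Q-1$; - $\sum_{l=1}^Q q_{v_l}\le Q$. The set $V_{i^-}$ is defined in the same way, with $v_1=i^-$ and with the condition $f^1_{v_l,i}+f^2_{i,v_l}\ge 1$ in place of $f^1_{i,v_l}+f^2_{i,v_l}\ge1$. Let $V_0=\{(0,\dots,0)\}$ and $V=V_0\cup\bigcup_{i\in R}(V_{i^+}\cup V_{i^-})$. The arc set is $A=A_1\cup\dots\cup A_6\subseteq V\times V$, where $(v,w)\in V\times V$ belongs to: - $A_1$ if $v_1=i^+$, $w_1=j^-$ for some $i,j\in R$ and $\{i,v_2,\dots,v_Q\}=\{j,w_2,\dots,w_Q\}$;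 - $A_2$ if $v_1=i^+$, $w_1=j^+$ for some $i,j\in R$, $Q\ge2$, $v_Q=0$ and $\{i,v_2,\dots,v_{Q-1}\}=\{w_2,\dots,w_Q\}$; - $A_3$ if $v_1=i^-$, $w_1=j^+$ with $i\ne j$ and $v_l=w_l$ for $l=2,\dots,Q$; - $A_4$ if $v_1=i^-$, $w_1=j^-$ for some $i,j\in R$, $Q\ge 2$, $w_Q=0$ and $\{v_2,\dots,v_Q\}=\{j,w_2,\dots,w_{Q-1}\}$; - $A_5$ if $v=(i^-,0,\dots,0)$ for some $i\in R$ and $w=(0,\dots,0)$; - $A_6$ if $v=(0,\dots,0)$ and $w=(i^+,0,\dots,0)$ for some $i\in R$. For $a=(v,w)\in A$ let $c_a=\bar c_{v_1w_1}$. Let $\delta^{in}(v)$ and $\delta^{out}(v)$ be the sets of arcs entering and leaving $v$. For $i\in J$ put $i^{s}=i$ if $i\neq0$ and $0^{s}=0^+$. For $j\in J$ put $j^{t}=j$ if $j\ne0$ and $0^{t}=0^-$. **LAEB formulation.** Minimize $\sum_{a\in A}c_ax_a$ over $(x_a)_{a\in A}$, $(\bar B_j)_{j\in\bar J}$ subject to - $e_j\le\bar B_j\le\ell_j$ for all $j\in\bar J$; - $\bar B_{i^-}-\bar B_{i^+}-s_i\le L_i$ for all $i\in R$; - $\sum_{a\in\delta^{in}(v)}x_a-\sum_{a\in\delta^{out}(v)}x_a=0$ for all $v\in V$; - $\sum_{v\in V_{i^+}}\sum_{a\in\delta^{in}(v)}x_a=1$ for all $i\in R$; - $\sum_{a\in\delta^{out}((0,\dots,0))}x_a\le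 K$; - $\bar B_{j^t}\ge\bar B_{i^s}+s_i+\bar t_{ij}-\bar M_{i^sj^t}\bigl(1-\sum_{(v,w)\in A:\,v_1=i,\,w_1=j}x_{(v,w)}\bigr)$ for all $i,j\in J$; - $x_a\in\{0,1\}$ for all $a\in A$. *)

theory Defs
  imports Complex_Main "HOL-Library.Extended_Real"
begin

section \<open>Instances of the dial-a-ride problem\<close>

text \<open>
  \<open>Pick i\<close> is $i^+$, \<open>Drop i\<close> is $i^-$, and \<open>Depot\<close>, \<open>Source\<close>, \<open>Sink\<close> are $0$, $0^+$, $0^-$.
\<close>

datatype loc = Depot | Source | Sink | Pick nat | Drop nat

text \<open>The request a location belongs to; the depot and its copies belong to the dummy request 0.\<close>

fun req_of :: "loc \<Rightarrow> nat" where
  "req_of (Pick i) = i"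
| "req_of (Drop i) = i"
| "req_of _ = 0"

text \<open>Both copies of the depot inherit the data of the depot.\<close>

fun base :: "loc \<Rightarrow> loc" where
  "base Source = Depot"
| "base Sink = Depot"
| "base j = j"

text \<open>
  Travel times, costs and time windows are primitive on \<open>J\<close> and extended to the depot copies
  below; the constants \<open>bigM\<close> are indexed by \<open>Jbar\<close>.
\<close>

record darp =
  num_req :: nat
  persons :: "nat \<Rightarrow> nat"
  service :: "nat \<Rightarrow> real"
  max_ride :: "nat \<Rightarrow> real"
  capacity :: nat
  vehicles :: nat
  travel0 :: "loc \<Rightarrow> loc \<Rightarrow> real"
  cost0 :: "loc \<Rightarrow> loc \<Rightarrow> real"
  earliest0 :: "loc \<Rightarrow> real"
  latest0 :: "loc \<Rightarrow> real"
  duration :: real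
  bigM :: "loc \<Rightarrow> loc \<Rightarrow> real"

definition requests :: "darp \<Rightarrow> nat set" where
  "requests I = {1..num_req I}"

definition pickups :: "darp \<Rightarrow> loc set" where
  "pickups I = Pick ` requests I"

definition dropoffs :: "darp \<Rightarrow> loc set" where
  "dropoffs I = Drop ` requests I"

definition J :: "darp \<Rightarrow> loc set" where
  "J I = pickups I \<union> dropoffs I \<union> {Depot}"

definition Jbar :: "darp \<Rightarrow> loc set" where
  "Jbar I = pickups I \<union> dropoffs I \<union> {Source, Sink}"

definition travel :: "darp \<Rightarrow> loc \<Rightarrow> loc \<Rightarrow> real" where
  "travel I i j = travel0 I (base i) (base j)"

definition cost :: "darp \<Rightarrow> loc \<Rightarrow> loc \<Rightarrow> real" where
  "cost I i j = cost0 I (base i) (base j)"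

definition earliest :: "darp \<Rightarrow> loc \<Rightarrow> real" where
  "earliest I j = earliest0 I (base j)"

definition latest :: "darp \<Rightarrow> loc \<Rightarrow> real" where
  "latest I j = latest0 I (base j)"

definition service_at :: "darp \<Rightarrow> loc \<Rightarrow> real" where
  "service_at I j = service I (req_of j)"

definition persons_at :: "darp \<Rightarrow> loc \<Rightarrow> nat" where
  "persons_at I j = persons I (req_of j)"

definition darp_instance :: "darp \<Rightarrow> bool" where
  "darp_instance I \<longleftrightarrow>
     (\<forall>i\<in>requests I. persons I i > 0 \<and> service I i \<ge> 0) \<and>
     persons I 0 = 0 \<and> service I 0 = 0 \<and>
     capacity I > 0 \<and>
     (\<forall>i\<in>J I. \<forall>j\<in>J I. travel I i j \<ge> 0 \<and> cost I i j \<ge> 0) \<and>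
     (\<forall>i\<in>J I. \<forall>j\<in>J I. \<forall>k\<in>J I.
        travel I i k \<le> travel I i j + travel I j k \<and>
        cost I i k \<le> cost I i j + cost I j k) \<and>
     (\<forall>i\<in>requests I. 0 < travel I (Pick i) (Drop i) + service I i \<and>
        travel I (Pick i) (Drop i) + service I i < max_ride I i) \<and>
     earliest I Depot = 0 \<and>
     latest I Depot = earliest I Depot + duration I \<and>
     (\<forall>i\<in>requests I. earliest I (Pick i) \<ge> travel I Depot (Pick i)) \<and>
     (\<forall>i\<in>Jbar I. \<forall>j\<in>Jbar I.
        bigM I i j \<ge> latest I i + service_at I i + travel I i j - earliest I j)"

section \<open>Optimal values\<close>

text \<open>
  The objective value of an optimal solution of the minimization of \<open>f\<close> over the feasible set \<open>X\<close>,
  and \<open>\<infinity>\<close> if there is no optimal solution. For the linear programs below, whose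
  variables are all bounded, the latter happens exactly if \<open>X\<close> is empty.
\<close>

definition opt_value :: "'a set \<Rightarrow> ('a \<Rightarrow> real) \<Rightarrow> ereal" where
  "opt_value X f =
     (if \<exists>x. is_arg_min f (\<lambda>x. x \<in> X) x then ereal (f (ARG_MIN f x. x \<in> X)) else \<infinity>)"

section \<open>The location-based formulation\<close>

definition prec_sets :: "darp \<Rightarrow> loc set set" where
  "prec_sets I = {S. S \<subseteq> Jbar I \<and> Source \<in> S \<and> Sink \<notin> S \<and>
     (\<exists>i\<in>requests I. Pick i \<notin> S \<and> Drop i \<in> S)}"

definition load_change :: "darp \<Rightarrow> loc \<Rightarrow> real" where
  "load_change I j = (if j \<in> pickups I then 1 else - 1) * real (persons_at I j)"

text \<open>
  The parameter \<open>X\<close> is the domain of the routing variables: \<open>{0, 1}\<close> gives the mixed-integer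
  program and \<open>{0..1}\<close> its LP relaxation.
\<close>

definition LB_feasible ::
  "darp \<Rightarrow> real set \<Rightarrow> ((loc \<Rightarrow> loc \<Rightarrow> real) \<times> (loc \<Rightarrow> real) \<times> (loc \<Rightarrow> real)) set" where
  "LB_feasible I X = {(x, B, L).
     (\<forall>j\<in>pickups I \<union> dropoffs I. (\<Sum>i\<in>Jbar I. x i j) = 1) \<and>
     (\<forall>i\<in>pickups I \<union> dropoffs I. (\<Sum>j\<in>Jbar I. x i j) = 1) \<and>
     (\<Sum>j\<in>pickups I. x Source j) \<le> real (vehicles I) \<and>
     (\<forall>S\<in>prec_sets I. (\<Sum>i\<in>S. \<Sum>j\<in>S. x i j) \<le> real (card S) - 2) \<and>
     (\<forall>i\<in>Jbar I. \<forall>j\<in>Jbar I.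
        B i + service_at I i + travel I i j - bigM I i j * (1 - x i j) \<le> B j) \<and>
     (\<forall>i\<in>Jbar I. \<forall>j\<in>Jbar I.
        L i + load_change I j - real (capacity I) * (1 - x i j) \<le> L j) \<and>
     (\<forall>j\<in>Jbar I. earliest I j \<le> B j \<and> B j \<le> latest I j) \<and>
     (\<forall>j\<in>Jbar I. max 0 (load_change I j) \<le> L j \<and>
        L j \<le> min (real (capacity I)) (real (capacity I) + load_change I j)) \<and>
     (\<forall>i\<in>requests I. B (Drop i) - B (Pick i) - service I i \<le> max_ride I i) \<and>
     (\<forall>i\<in>Jbar I. \<forall>j\<in>Jbar I. x i j \<in> X)}"

definition LB_objective ::
  "darp \<Rightarrow> (loc \<Rightarrow> loc \<Rightarrow> real) \<times> (loc \<Rightarrow> real) \<times> (loc \<Rightarrow> real) \<Rightarrow> real" where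
  "LB_objective I = (\<lambda>(x, B, L). \<Sum>i\<in>Jbar I. \<Sum>j\<in>Jbar I. cost I i j * x i j)"

definition Z_LB_rel :: "darp \<Rightarrow> ereal" where
  "Z_LB_rel I = opt_value (LB_feasible I {0..1}) (LB_objective I)"

section \<open>The event-based graph\<close>

text \<open>
  A path visiting pairwise distinct locations is feasible with respect to time windows and maximum
  ride times if its locations admit a schedule of service start times.
\<close>

definition path_feasible :: "darp \<Rightarrow> loc list \<Rightarrow> bool" where
  "path_feasible I p \<longleftrightarrow> (\<exists>B :: loc \<Rightarrow> real.
     (\<forall>j\<in>set p. earliest I j \<le> B j \<and> B j \<le> latest I j) \<and>
     (\<forall>k. Suc k < length p \<longrightarrow>
        B (p ! k) + service_at I (p ! k) + travel I (p ! k) (p ! Suc k) \<le> B (p ! Suc k)) \<and>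
     (\<forall>i\<in>requests I. Pick i \<in> set p \<and> Drop i \<in> set p \<longrightarrow>
        B (Drop i) - B (Pick i) - service I i \<le> max_ride I i))"

definition f1 :: "darp \<Rightarrow> nat \<Rightarrow> nat \<Rightarrow> nat" where
  "f1 I i j = (if i = 0 \<or> j = 0 \<or> path_feasible I [Pick j, Pick i, Drop j, Drop i] then 1 else 0)"

definition f2 :: "darp \<Rightarrow> nat \<Rightarrow> nat \<Rightarrow> nat" where
  "f2 I i j = (if i = 0 \<or> j = 0 \<or> path_feasible I [Pick j, Pick i, Drop i, Drop j] then 1 else 0)"

text \<open>
  The tuple $(v_1, v_2, \dots, v_Q)$ is the pair of the location $v_1$ and the list
  $[v_2, \dots, v_Q]$ of length $Q - 1$, so list index \<open>k\<close> holds $v_{k+2}$.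
\<close>

type_synonym event = "loc \<times> nat list"

definition valid_tuple :: "darp \<Rightarrow> event \<Rightarrow> bool" where
  "valid_tuple I v \<longleftrightarrow>
     length (snd v) = capacity I - 1 \<and>
     set (snd v) \<subseteq> (requests I \<union> {0}) - {req_of (fst v)} \<and>
     (\<forall>k. Suc k < length (snd v) \<longrightarrow> snd v ! k > snd v ! Suc k \<or> snd v ! Suc k = 0) \<and>
     persons_at I (fst v) + (\<Sum>r\<leftarrow>snd v. persons I r) \<le> capacity I"

definition V_pick :: "darp \<Rightarrow> nat \<Rightarrow> event set" where
  "V_pick I i = {v. fst v = Pick i \<and> valid_tuple I v \<and>
     (\<forall>r\<in>set (snd v). f1 I i r + f2 I i r \<ge> 1)}"

definition V_drop :: "darp \<Rightarrow> nat \<Rightarrow> event set" where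
  "V_drop I i = {v. fst v = Drop i \<and> valid_tuple I v \<and>
     (\<forall>r\<in>set (snd v). f1 I r i + f2 I i r \<ge> 1)}"

definition zero_event :: "darp \<Rightarrow> event" where
  "zero_event I = (Depot, replicate (capacity I - 1) 0)"

definition V :: "darp \<Rightarrow> event set" where
  "V I = {zero_event I} \<union> (\<Union>i\<in>requests I. V_pick I i \<union> V_drop I i)"

definition A1 :: "darp \<Rightarrow> (event \<times> event) set" where
  "A1 I = {(v, w) \<in> V I \<times> V I. \<exists>i\<in>requests I. \<exists>j\<in>requests I.
     fst v = Pick i \<and> fst w = Drop j \<and> insert i (set (snd v)) = insert j (set (snd w))}"

definition A2 :: "darp \<Rightarrow> (event \<times> event) set" where
  "A2 I = {(v, w) \<in> V I \<times> V I. \<exists>i\<in>requests I. \<exists>j\<in>requests I.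
     fst v = Pick i \<and> fst w = Pick j \<and> capacity I \<ge> 2 \<and> last (snd v) = 0 \<and>
     insert i (set (butlast (snd v))) = set (snd w)}"

definition A3 :: "darp \<Rightarrow> (event \<times> event) set" where
  "A3 I = {(v, w) \<in> V I \<times> V I. \<exists>i\<in>requests I. \<exists>j\<in>requests I.
     fst v = Drop i \<and> fst w = Pick j \<and> i \<noteq> j \<and> snd v = snd w}"

definition A4 :: "darp \<Rightarrow> (event \<times> event) set" where
  "A4 I = {(v, w) \<in> V I \<times> V I. \<exists>i\<in>requests I. \<exists>j\<in>requests I.
     fst v = Drop i \<and> fst w = Drop j \<and> capacity I \<ge> 2 \<and> last (snd w) = 0 \<and>
     set (snd v) = insert j (set (butlast (snd w)))}"

definition A5 :: "darp \<Rightarrow> (event \<times> event) set" where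
  "A5 I = {(v, w) \<in> V I \<times> V I. \<exists>i\<in>requests I.
     v = (Drop i, replicate (capacity I - 1) 0) \<and> w = zero_event I}"

definition A6 :: "darp \<Rightarrow> (event \<times> event) set" where
  "A6 I = {(v, w) \<in> V I \<times> V I. \<exists>i\<in>requests I.
     v = zero_event I \<and> w = (Pick i, replicate (capacity I - 1) 0)}"

definition A :: "darp \<Rightarrow> (event \<times> event) set" where
  "A I = A1 I \<union> A2 I \<union> A3 I \<union> A4 I \<union> A5 I \<union> A6 I"

definition in_arcs :: "darp \<Rightarrow> event \<Rightarrow> (event \<times> event) set" where
  "in_arcs I v = {a \<in> A I. snd a = v}"

definition out_arcs :: "darp \<Rightarrow> event \<Rightarrow> (event \<times> event) set" where
  "out_arcs I v = {a \<in> A I. fst a = v}"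

lemma finite_V: "finite (V I)"
proof (rule finite_subset)
  let ?F = "{Depot} \<union> Pick ` requests I \<union> Drop ` requests I"
  let ?L = "{vs. set vs \<subseteq> {0..num_req I} \<and> length vs = capacity I - 1}"
  show "V I \<subseteq> ?F \<times> ?L"
    by (auto simp: V_def V_pick_def V_drop_def valid_tuple_def zero_event_def requests_def
        image_iff; fastforce)
  show "finite (?F \<times> ?L)"
    by (intro finite_cartesian_product finite_lists_length_eq) (auto simp: requests_def)
qed

lemma finite_A: "finite (A I)"
  by (rule finite_subset[of _ "V I \<times> V I"])
    (auto simp: A_def A1_def A2_def A3_def A4_def A5_def A6_def finite_V)

section \<open>The location-augmented event-based formulation\<close>

definition as_source :: "loc \<Rightarrow> loc" where
  "as_source i = (if i = Depot then Source else i)"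

definition as_sink :: "loc \<Rightarrow> loc" where
  "as_sink j = (if j = Depot then Sink else j)"

definition LAEB_feasible ::
  "darp \<Rightarrow> real set \<Rightarrow> ((event \<times> event \<Rightarrow> real) \<times> (loc \<Rightarrow> real)) set" where
  "LAEB_feasible I X = {(x, B).
     (\<forall>j\<in>Jbar I. earliest I j \<le> B j \<and> B j \<le> latest I j) \<and>
     (\<forall>i\<in>requests I. B (Drop i) - B (Pick i) - service I i \<le> max_ride I i) \<and>
     (\<forall>v\<in>V I. (\<Sum>a\<in>in_arcs I v. x a) - (\<Sum>a\<in>out_arcs I v. x a) = 0) \<and>
     (\<forall>i\<in>requests I. (\<Sum>v\<in>V_pick I i. \<Sum>a\<in>in_arcs I v. x a) = 1) \<and>
     (\<Sum>a\<in>out_arcs I (zero_event I). x a) \<le> real (vehicles I) \<and>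
     (\<forall>i\<in>J I. \<forall>j\<in>J I.
        B (as_sink j) \<ge> B (as_source i) + service_at I i + travel I i j
          - bigM I (as_source i) (as_sink j)
            * (1 - (\<Sum>a\<in>{(v, w) \<in> A I. fst v = i \<and> fst w = j}. x a))) \<and>
     (\<forall>a\<in>A I. x a \<in> X)}"

definition LAEB_objective :: "darp \<Rightarrow> (event \<times> event \<Rightarrow> real) \<times> (loc \<Rightarrow> real) \<Rightarrow> real" where
  "LAEB_objective I = (\<lambda>(x, B). \<Sum>(v, w)\<in>A I. cost I (fst v) (fst w) * x (v, w))"

definition Z_LAEB_rel :: "darp \<Rightarrow> ereal" where
  "Z_LAEB_rel I = opt_value (LAEB_feasible I {0..1}) (LAEB_objective I)"

end

theory Submission
  imports Defs "HOL-Analysis.Function_Topology"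
begin

text \<open>
  A feasible point of the LAEB relaxation is a circulation in the event graph. Summing it over all
  arcs between events at given locations yields routing variables of the LB relaxation with the
  same cost, and the loads are the flow-weighted averages of the loads of the events at a location.
  A request boards exactly at its pick-up and leaves exactly at its delivery along every arc, so
  applying flow conservation to the events with the request on board yields the degree constraint
  at the delivery and the precedence constraints. The LB relaxation attains its minimum by
  compactness.
\<close>

section \<open>Requests on board along an arc\<close>

text \<open>A fractional \<open>x\<close> does not describe one set of routes, so no argument
  follows a vehicle. Every claim is instead reduced to an equality or inequality that holds on each
  single arc; weighted by \<open>x\<close> and summed, it becomes the claim after conservation
  cancels what depends only on the two end events. The schedule \<open>B\<close> is carried over
  unchanged, because both formulations impose the same time constraint once the arc values between
  two locations are added up. The two programs need different care: \<open>opt_value\<close> is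
  \<infinity> without a minimiser, so an LAEB program without optimum makes the bound trivial,
  whereas an LB program with feasible points but no minimiser could break it. Hence attainment is
  proved for LB.\<close>

definition onboard :: "event \<Rightarrow> nat set" where
  "onboard v = (case fst v of Pick i \<Rightarrow> insert i (set (snd v)) | _ \<Rightarrow> set (snd v)) - {0}"

definition load :: "darp \<Rightarrow> event \<Rightarrow> real" where
  "load I v = (\<Sum>r\<in>onboard v. real (persons I r))"

lemma finite_onboard [simp]: "finite (onboard v)"
  by (auto simp: onboard_def split: loc.splits)

lemma onboard_zero_event [simp]: "onboard (zero_event I) = {}"
  by (auto simp: onboard_def zero_event_def)

lemma load_zero_event [simp]: "load I (zero_event I) = 0"
  by (simp add: load_def)

lemma load_nonneg: "0 \<le> load I v"
  by (simp add: load_def sum_nonneg)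

lemma requests_pos: "i \<in> requests I \<Longrightarrow> i > 0"
  by (simp add: requests_def)

lemma V_Pick: "v \<in> V I \<Longrightarrow> fst v = Pick i \<Longrightarrow> i \<in> requests I \<and> v \<in> V_pick I i \<and> valid_tuple I v"
  by (auto simp: V_def V_pick_def V_drop_def zero_event_def)

lemma V_Drop: "v \<in> V I \<Longrightarrow> fst v = Drop i \<Longrightarrow> i \<in> requests I \<and> valid_tuple I v"
  by (auto simp: V_def V_pick_def V_drop_def zero_event_def)

lemma V_pick_subset: "i \<in> requests I \<Longrightarrow> v \<in> V_pick I i \<Longrightarrow> v \<in> V I \<and> fst v = Pick i"
  by (auto simp: V_def V_pick_def)

lemma fst_V:
  assumes "v \<in> V I"
  obtains (Depot) "v = zero_event I"
  | (Pick) i where "i \<in> requests I" "fst v = Pick i"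
  | (Drop) i where "i \<in> requests I" "fst v = Drop i"
  using assms by (auto simp: V_def V_pick_def V_drop_def)

lemma onboard_Pick:
  assumes "v \<in> V I" "fst v = Pick i"
  shows "onboard v = insert i (set (snd v) - {0})" "i \<notin> set (snd v)"
  using V_Pick[OF assms] requests_pos[of i I] assms(2)
  by (auto simp: onboard_def valid_tuple_def)

lemma onboard_Drop:
  assumes "v \<in> V I" "fst v = Drop i"
  shows "onboard v = set (snd v) - {0}" "i \<notin> set (snd v)"
  using V_Drop[OF assms] requests_pos[of i I] assms(2)
  by (auto simp: onboard_def valid_tuple_def)

lemma arc_V: "a \<in> A I \<Longrightarrow> fst a \<in> V I \<and> snd a \<in> V I"
  by (auto simp: A_def A1_def A2_def A3_def A4_def A5_def A6_def)

lemma set_butlast_last: "xs \<noteq> [] \<Longrightarrow> last xs = 0 \<Longrightarrow> set xs - {0} = set (butlast xs) - {0::nat}"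
  by (cases xs rule: rev_cases) auto

text \<open>Arcs in \<open>A1\<close>, \<open>A2\<close> and \<open>A4\<close> compare tuples only
  as sets, which is why the requests on board form a set, without the filler 0. A valid tuple does
  not repeat its first request, so exactly one request enters or leaves. The cases follow the head
  of the arc instead of the six classes, since only what happens on arrival matters later.\<close>

lemma onboard_arc:
  assumes "a \<in> A I"
  shows "(\<exists>j\<in>requests I. fst (snd a) = Pick j \<and> onboard (snd a) = insert j (onboard (fst a)) \<and>
            j \<notin> onboard (fst a)) \<or>
         (\<exists>j\<in>requests I. fst (snd a) = Drop j \<and> onboard (fst a) = insert j (onboard (snd a)) \<and>
            j \<notin> onboard (snd a)) \<or>
         (snd a = zero_event I \<and> onboard (fst a) = {})"
    (is "?pick \<or> ?drop \<or> ?depot")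
proof -
  obtain v w where a: "a = (v, w)" by (cases a)
  have V: "v \<in> V I" "w \<in> V I" using arc_V[OF assms] a by auto
  note on = onboard_Pick[OF V(1)] onboard_Pick[OF V(2)] onboard_Drop[OF V(1)] onboard_Drop[OF V(2)]
  consider "a \<in> A1 I" | "a \<in> A2 I" | "a \<in> A3 I" | "a \<in> A4 I" | "a \<in> A5 I" | "a \<in> A6 I"
    using assms by (auto simp: A_def)
  then show ?thesis
  proof cases
    case 1
    then obtain i j where ij: "i \<in> requests I" "j \<in> requests I" "fst v = Pick i" "fst w = Drop j"
      "insert i (set (snd v)) = insert j (set (snd w))"
      by (auto simp: A1_def a)
    have "onboard v = insert i (set (snd v)) - {0}"
      using on ij requests_pos[OF ij(1)] by auto
    then have "onboard v = insert j (onboard w)" "j \<notin> onboard w"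
      using on ij requests_pos[OF ij(2)] by auto
    then show ?thesis using ij a by auto
  next
    case 2
    then obtain i j where ij: "i \<in> requests I" "j \<in> requests I" "fst v = Pick i" "fst w = Pick j"
      "capacity I \<ge> 2" "last (snd v) = 0" "insert i (set (butlast (snd v))) = set (snd w)"
      by (auto simp: A2_def a)
    \<comment> \<open>\<open>capacity I \<ge> 2\<close> guarantees a seat beyond the first, so
      \<open>last\<close> and \<open>butlast\<close> speak about an actual entry.\<close>
    have "snd v \<noteq> []"
      using V_Pick[OF V(1) ij(3)] ij(5) by (auto simp: valid_tuple_def)
    then have "onboard v = set (snd w) - {0}"
      using on ij requests_pos[OF ij(1)] set_butlast_last[of "snd v"] by auto
    then have "onboard w = insert j (onboard v)" "j \<notin> onboard v"
      using on ij requests_pos[OF ij(2)] by auto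
    then show ?thesis using ij a by auto
  next
    case 3
    then obtain i j where ij: "i \<in> requests I" "j \<in> requests I" "fst v = Drop i" "fst w = Pick j"
      "snd v = snd w"
      by (auto simp: A3_def a)
    then have "onboard w = insert j (onboard v)" "j \<notin> onboard v"
      using on by auto
    then show ?thesis using ij a by auto
  next
    case 4
    then obtain i j where ij: "i \<in> requests I" "j \<in> requests I" "fst v = Drop i" "fst w = Drop j"
      "capacity I \<ge> 2" "last (snd w) = 0" "set (snd v) = insert j (set (butlast (snd w)))"
      by (auto simp: A4_def a)
    have "snd w \<noteq> []"
      using V_Drop[OF V(2) ij(4)] ij(5) by (auto simp: valid_tuple_def)
    then have "onboard v = insert j (onboard w)" "j \<notin> onboard w"
      using on ij requests_pos[OF ij(2)] set_butlast_last[of "snd w"] by auto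
    then show ?thesis using ij a by auto
  next
    case 5
    then have "onboard v = {}" "w = zero_event I"
      by (auto simp: A5_def a onboard_def)
    then show ?thesis using a by simp
  next
    case 6
    then obtain i where i: "i \<in> requests I" "v = zero_event I" "w = (Pick i, replicate (capacity I - 1) 0)"
      by (auto simp: A6_def a)
    then have "onboard w = {i}" using requests_pos[OF i(1)] by (auto simp: onboard_def)
    then show ?thesis using i a by auto
  qed
qed

section \<open>Loads along arcs and their bounds\<close>

lemma load_change_simps:
  assumes "darp_instance I"
  shows "i \<in> requests I \<Longrightarrow> load_change I (Pick i) = real (persons I i)"
    "load_change I (Drop i) = - real (persons I i)"
    "load_change I Source = 0" "load_change I Sink = 0"
  using assms by (auto simp: load_change_def pickups_def persons_at_def darp_instance_def)

lemma load_arc: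
  assumes "darp_instance I" "a \<in> A I"
  shows "load I (snd a) = load I (fst a) + load_change I (as_sink (fst (snd a)))"
  using onboard_arc[OF assms(2)]
proof (elim disjE bexE conjE)
  fix j assume "j \<in> requests I" "fst (snd a) = Pick j" "onboard (snd a) = insert j (onboard (fst a))"
    "j \<notin> onboard (fst a)"
  then show ?thesis
    by (simp add: load_def as_sink_def load_change_simps[OF assms(1)])
next
  fix j assume "j \<in> requests I" "fst (snd a) = Drop j" "onboard (fst a) = insert j (onboard (snd a))"
    "j \<notin> onboard (snd a)"
  then show ?thesis
    by (simp add: load_def as_sink_def load_change_simps[OF assms(1)])
next
  assume "snd a = zero_event I" "onboard (fst a) = {}"
  then show ?thesis
    by (simp add: load_def as_sink_def load_change_simps[OF assms(1)])
      (simp add: zero_event_def load_change_simps[OF assms(1)])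
qed

lemma sum_set_le_sum_list:
  fixes f :: "'a \<Rightarrow> nat"
  shows "sum f (set xs) \<le> (\<Sum>x\<leftarrow>xs. f x)"
  by (induction xs) (auto simp: sum.insert_if)

text \<open>\<open>valid_tuple\<close> counts the persons of the request at \<open>fst v\<close> for
  both kinds of event. At a pick-up they belong to the load; at a delivery they have just left, and
  their seats are exactly the slack in the sharper upper bound.\<close>

lemma load_bounds:
  assumes "darp_instance I" "v \<in> V I"
  shows "max 0 (load_change I (as_sink (fst v))) \<le> load I v"
    "load I v \<le> min (real (capacity I)) (real (capacity I) + load_change I (as_sink (fst v)))"
proof -
  have "max 0 (load_change I (as_sink (fst v))) \<le> load I v \<and>
    load I v \<le> min (real (capacity I)) (real (capacity I) + load_change I (as_sink (fst v)))"
    using assms(2)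
  proof (cases rule: fst_V)
    case Depot
    then show ?thesis
      by (simp add: as_sink_def) (simp add: zero_event_def load_change_simps[OF assms(1)])
  next
    case (Pick i)
    let ?s = "\<Sum>r\<in>set (snd v) - {0}. persons I r"
    have "?s \<le> sum (persons I) (set (snd v))"
      by (rule sum_mono2) auto
    also have "\<dots> \<le> (\<Sum>r\<leftarrow>snd v. persons I r)"
      by (rule sum_set_le_sum_list)
    finally have "persons I i + ?s \<le> capacity I"
      using V_Pick[OF assms(2) Pick(2)] Pick(2) by (auto simp: valid_tuple_def persons_at_def)
    moreover have "load I v = real (persons I i + ?s)"
      using onboard_Pick[OF assms(2) Pick(2)] by (simp add: load_def)
    ultimately show ?thesis
      by (simp add: Pick as_sink_def load_change_simps[OF assms(1)] del: of_nat_sum)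
  next
    case (Drop i)
    let ?s = "\<Sum>r\<in>set (snd v) - {0}. persons I r"
    have "?s \<le> sum (persons I) (set (snd v))"
      by (rule sum_mono2) auto
    also have "\<dots> \<le> (\<Sum>r\<leftarrow>snd v. persons I r)"
      by (rule sum_set_le_sum_list)
    finally have "persons I i + ?s \<le> capacity I"
      using V_Drop[OF assms(2) Drop(2)] Drop(2) by (auto simp: valid_tuple_def persons_at_def)
    moreover have "load I v = real ?s"
      using onboard_Drop[OF assms(2) Drop(2)] by (simp add: load_def)
    ultimately show ?thesis
      by (simp add: Drop as_sink_def load_change_simps[OF assms(1)] del: of_nat_sum)
  qed
  then show "max 0 (load_change I (as_sink (fst v))) \<le> load I v"
    "load I v \<le> min (real (capacity I)) (real (capacity I) + load_change I (as_sink (fst v)))"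
    by auto
qed

section \<open>Projecting LAEB points to LB points\<close>

definition tail :: "event \<times> event \<Rightarrow> loc" where
  "tail a = as_source (fst (fst a))"

definition head :: "event \<times> event \<Rightarrow> loc" where
  "head a = as_sink (fst (snd a))"

text \<open>\<open>as_source\<close> of the head event is recorded because it is the tail of every
  arc that continues from there. It differs from \<open>head a\<close> only at the depot, where
  nobody is on board.\<close>

lemma arc_cases [consumes 1]:
  assumes "a \<in> A I"
  obtains
    (Pick) j where "head a = Pick j" "as_source (fst (snd a)) = Pick j"
      "onboard (snd a) = insert j (onboard (fst a))" "j \<notin> onboard (fst a)"
  | (Drop) j where "head a = Drop j" "as_source (fst (snd a)) = Drop j"
      "onboard (fst a) = insert j (onboard (snd a))" "j \<notin> onboard (snd a)"
  | (Depot) "head a = Sink" "onboard (fst a) = {}" "onboard (snd a) = {}"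
  using onboard_arc[OF assms]
proof (elim disjE bexE conjE)
  fix j
  assume "fst (snd a) = loc.Pick j" "onboard (snd a) = insert j (onboard (fst a))"
    "j \<notin> onboard (fst a)"
  then show thesis by (intro Pick[of j]) (simp_all add: head_def as_sink_def as_source_def)
next
  fix j
  assume "fst (snd a) = loc.Drop j" "onboard (fst a) = insert j (onboard (snd a))"
    "j \<notin> onboard (snd a)"
  then show thesis by (intro Drop[of j]) (simp_all add: head_def as_sink_def as_source_def)
next
  assume "snd a = zero_event I" "onboard (fst a) = {}"
  then show thesis by (intro Depot) (simp_all add: head_def as_sink_def, simp add: zero_event_def)
qed

lemma finite_Jbar [simp]: "finite (Jbar I)"
  by (simp add: Jbar_def pickups_def dropoffs_def requests_def)

lemma head_tail_Jbar:
  assumes "a \<in> A I"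
  shows "tail a \<in> Jbar I - {Sink}" "head a \<in> Jbar I - {Source}"
proof -
  have "as_source (fst v) \<in> Jbar I - {Sink} \<and> as_sink (fst v) \<in> Jbar I - {Source}" if "v \<in> V I" for v
    using that by (cases rule: fst_V)
      (auto simp: as_source_def as_sink_def Jbar_def pickups_def dropoffs_def zero_event_def)
  then show "tail a \<in> Jbar I - {Sink}" "head a \<in> Jbar I - {Source}"
    using arc_V[OF assms] by (simp_all add: tail_def head_def)
qed

lemma head_tail_eq:
  assumes "a \<in> A I"
  shows "tail a = Source \<longleftrightarrow> fst (fst a) = Depot" "head a = Sink \<longleftrightarrow> fst (snd a) = Depot"
proof -
  have "fst v \<noteq> Source \<and> fst v \<noteq> Sink" if "v \<in> V I" for v
    using that by (cases rule: fst_V) (auto simp: zero_event_def)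
  then have "fst (fst a) \<noteq> Source" "fst (snd a) \<noteq> Sink" using arc_V[OF assms] by auto
  then show "tail a = Source \<longleftrightarrow> fst (fst a) = Depot" "head a = Sink \<longleftrightarrow> fst (snd a) = Depot"
    by (simp_all add: tail_def head_def as_source_def as_sink_def)
qed

lemma fst_V_J: "v \<in> V I \<Longrightarrow> fst v \<in> J I"
  by (cases rule: fst_V) (auto simp: J_def pickups_def dropoffs_def zero_event_def)

lemma as_source_eq: "k \<in> J I \<Longrightarrow> i \<in> Jbar I \<Longrightarrow> i \<noteq> Sink \<Longrightarrow> as_source k = i \<longleftrightarrow> k = base i"
  by (auto simp: J_def Jbar_def pickups_def dropoffs_def as_source_def)

lemma as_sink_eq: "k \<in> J I \<Longrightarrow> j \<in> Jbar I \<Longrightarrow> j \<noteq> Source \<Longrightarrow> as_sink k = j \<longleftrightarrow> k = base j"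
  by (auto simp: J_def Jbar_def pickups_def dropoffs_def as_sink_def)

lemma sum_of_bool_pair:
  fixes c :: "'a \<Rightarrow> 'b \<Rightarrow> real"
  assumes "finite S" "finite T"
  shows "(\<Sum>i\<in>S. \<Sum>j\<in>T. c i j * of_bool (p = i \<and> q = j)) = of_bool (p \<in> S \<and> q \<in> T) * c p q"
proof -
  have "(\<Sum>i\<in>S. \<Sum>j\<in>T. c i j * of_bool (p = i \<and> q = j)) =
        (\<Sum>i\<in>S. if p = i then \<Sum>j\<in>T. if q = j then c p q else 0 else 0)"
    by (auto intro!: sum.cong)
  also have "\<dots> = of_bool (p \<in> S \<and> q \<in> T) * c p q"
    using assms by (simp add: sum.delta')
  finally show ?thesis .
qed

section \<open>The flow functional of a feasible LAEB point\<close>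

locale LAEB_point =
  fixes I :: darp and x :: "event \<times> event \<Rightarrow> real" and B :: "loc \<Rightarrow> real"
  assumes inst: "darp_instance I"
    and feasible: "(x, B) \<in> LAEB_feasible I {0..1}"
begin

lemma x_nonneg: "a \<in> A I \<Longrightarrow> 0 \<le> x a"
  using feasible by (auto simp: LAEB_feasible_def)

definition flow :: "(event \<times> event \<Rightarrow> real) \<Rightarrow> real" where
  "flow \<phi> = (\<Sum>a\<in>A I. x a * \<phi> a)"

lemma flow_mono: "(\<And>a. a \<in> A I \<Longrightarrow> \<phi> a \<le> \<psi> a) \<Longrightarrow> flow \<phi> \<le> flow \<psi>"
  by (auto simp: flow_def intro!: sum_mono mult_left_mono x_nonneg)

lemma flow_cong: "(\<And>a. a \<in> A I \<Longrightarrow> \<phi> a = \<psi> a) \<Longrightarrow> flow \<phi> = flow \<psi>"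
  by (simp add: flow_def)

lemma flow_add: "flow (\<lambda>a. \<phi> a + \<psi> a) = flow \<phi> + flow \<psi>"
  by (simp add: flow_def algebra_simps sum.distrib)

lemma flow_diff: "flow (\<lambda>a. \<phi> a - \<psi> a) = flow \<phi> - flow \<psi>"
  by (simp add: flow_def algebra_simps sum_subtractf)

lemma flow_scale: "flow (\<lambda>a. c * \<phi> a) = c * flow \<phi>"
  by (simp add: flow_def sum_distrib_left algebra_simps)

lemma flow_sum: "flow (\<lambda>a. \<Sum>i\<in>S. \<phi> i a) = (\<Sum>i\<in>S. flow (\<phi> i))"
  unfolding flow_def sum_distrib_left by (rule sum.swap)

lemma flow_eq_0: "(\<And>a. a \<in> A I \<Longrightarrow> \<phi> a = 0) \<Longrightarrow> flow \<phi> = 0"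
  by (simp add: flow_def)

lemma flow_of_bool: "flow (\<lambda>a. of_bool (p a)) = (\<Sum>a\<in>{a \<in> A I. p a}. x a)"
  unfolding flow_def by (rule sum.mono_neutral_cong_right) (auto simp: finite_A)

text \<open>Weak form of conservation: the equation at each event \<open>v\<close> is multiplied by
  \<open>h v\<close> and all are added. The potentials chosen later are indicators of a request on
  board or of a location, possibly weighted by the load.\<close>

lemma flow_conservation: "flow (\<lambda>a. h (snd a)) = flow (\<lambda>a. h (fst a))"
proof -
  have "flow (\<lambda>a. h (snd a)) = (\<Sum>v\<in>V I. \<Sum>a\<in>in_arcs I v. x a * h (snd a))"
    unfolding flow_def in_arcs_def
    by (rule sum.group[symmetric]) (auto simp: finite_A finite_V dest: arc_V)
  also have "\<dots> = (\<Sum>v\<in>V I. (\<Sum>a\<in>in_arcs I v. x a) * h v)"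
    by (auto simp: sum_distrib_right in_arcs_def intro!: sum.cong)
  also have "\<dots> = (\<Sum>v\<in>V I. (\<Sum>a\<in>out_arcs I v. x a) * h v)"
    using feasible by (intro sum.cong) (auto simp: LAEB_feasible_def)
  also have "\<dots> = (\<Sum>v\<in>V I. \<Sum>a\<in>out_arcs I v. x a * h (fst a))"
    by (auto simp: sum_distrib_right out_arcs_def intro!: sum.cong)
  also have "\<dots> = flow (\<lambda>a. h (fst a))"
    unfolding flow_def out_arcs_def
    by (rule sum.group) (auto simp: finite_A finite_V dest: arc_V)
  finally show ?thesis .
qed

section \<open>Unit flow through the locations of a request\<close>

lemma flow_into_Pick:
  assumes "i \<in> requests I"
  shows "flow (\<lambda>a. of_bool (head a = Pick i)) = 1"
proof -
  have V: "V_pick I i \<subseteq> V I" using V_pick_subset[OF assms] by blast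
  have fin: "finite (V_pick I i)" using finite_subset[OF V finite_V] .
  have "1 = (\<Sum>v\<in>V_pick I i. \<Sum>a\<in>in_arcs I v. x a)"
    using feasible assms by (simp add: LAEB_feasible_def)
  also have "\<dots> = (\<Sum>v\<in>V_pick I i. \<Sum>a\<in>{a. a \<in> {a \<in> A I. snd a \<in> V_pick I i} \<and> snd a = v}. x a)"
    by (intro sum.cong) (auto simp: in_arcs_def)
  also have "\<dots> = (\<Sum>a\<in>{a \<in> A I. snd a \<in> V_pick I i}. x a)"
    by (rule sum.group) (auto simp: finite_A fin)
  also have "\<dots> = flow (\<lambda>a. of_bool (head a = Pick i))"
    unfolding flow_of_bool
  proof (rule sum.cong)
    show "{a \<in> A I. snd a \<in> V_pick I i} = {a \<in> A I. head a = Pick i}"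
    proof (intro Collect_cong conj_cong refl)
      fix a assume "a \<in> A I"
      then have "snd a \<in> V I" using arc_V by blast
      then have "snd a \<in> V_pick I i \<longleftrightarrow> fst (snd a) = Pick i"
        using V_pick_subset[OF assms] V_Pick by blast
      also have "\<dots> \<longleftrightarrow> head a = Pick i" by (auto simp: head_def as_sink_def)
      finally show "snd a \<in> V_pick I i \<longleftrightarrow> head a = Pick i" .
    qed
  qed simp
  finally show ?thesis by simp
qed

lemma flow_into_Drop:
  assumes "i \<in> requests I"
  shows "flow (\<lambda>a. of_bool (head a = Drop i)) = 1"
proof -
  let ?h = "\<lambda>v. of_bool (i \<in> onboard v) :: real"
  have "flow (\<lambda>a. ?h (snd a) + of_bool (head a = Drop i)) =
    flow (\<lambda>a. ?h (fst a) + of_bool (head a = Pick i))"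
  proof (rule flow_cong)
    fix a assume "a \<in> A I"
    then show "?h (snd a) + of_bool (head a = Drop i) = ?h (fst a) + of_bool (head a = Pick i)"
      by (cases rule: arc_cases) auto
  qed
  then show ?thesis
    using flow_conservation[of ?h] flow_into_Pick[OF assms] by (simp add: flow_add)
qed

lemma flow_in:
  assumes "j \<in> pickups I \<union> dropoffs I"
  shows "flow (\<lambda>a. of_bool (head a = j)) = 1"
  using assms flow_into_Pick flow_into_Drop by (auto simp: pickups_def dropoffs_def)

lemma head_eq: "j \<noteq> Depot \<Longrightarrow> j \<noteq> Sink \<Longrightarrow> head a = j \<longleftrightarrow> fst (snd a) = j"
  by (auto simp: head_def as_sink_def)

lemma tail_eq: "j \<noteq> Depot \<Longrightarrow> j \<noteq> Source \<Longrightarrow> tail a = j \<longleftrightarrow> fst (fst a) = j"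
  by (auto simp: tail_def as_source_def)

text \<open>Away from the depot, \<open>as_source\<close> and \<open>as_sink\<close> are the
  identity, so a potential supported on the events at \<open>j\<close> can be used. At the depot,
  outflow and inflow belong to different copies.\<close>

lemma flow_tail_eq_head:
  assumes "j \<in> pickups I \<union> dropoffs I"
  shows "flow (\<lambda>a. of_bool (tail a = j) * g (fst a)) = flow (\<lambda>a. of_bool (head a = j) * g (snd a))"
proof -
  have "j \<noteq> Depot" "j \<noteq> Source" "j \<noteq> Sink" using assms by (auto simp: pickups_def dropoffs_def)
  then show ?thesis
    using flow_conservation[of "\<lambda>v. of_bool (fst v = j) * g v"] by (simp add: head_eq tail_eq)
qed

lemma flow_out:
  assumes "j \<in> pickups I \<union> dropoffs I"
  shows "flow (\<lambda>a. of_bool (tail a = j)) = 1"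
  using flow_tail_eq_head[OF assms, of "\<lambda>_. 1"] flow_in[OF assms] by simp

text \<open>
  The unit of flow that carries request \<open>i\<close> from its pick-up outside \<open>S\<close> to its delivery inside
  \<open>S\<close> must enter \<open>S\<close>: compare inflow and outflow of the events outside \<open>S\<close> with \<open>i\<close> on board.
\<close>

lemma flow_cut:
  assumes "i \<in> requests I" "Pick i \<notin> S" "Drop i \<in> S"
  shows "flow (\<lambda>a. of_bool (tail a \<notin> S \<and> head a \<in> S)) \<ge> 1"
proof -
  let ?h = "\<lambda>v. of_bool (i \<in> onboard v \<and> as_source (fst v) \<notin> S) :: real"
  have "flow (\<lambda>a. ?h (fst a) + of_bool (head a = Pick i))
    \<le> flow (\<lambda>a. ?h (snd a) + of_bool (tail a \<notin> S \<and> head a \<in> S))"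
  \<comment> \<open>Since \<open>Drop i \<in> S\<close>, the request cannot leave the vehicle
    outside \<open>S\<close>; the indicator \<open>?h\<close> can fall from 1 to 0 only along an arc
    that enters \<open>S\<close>.\<close>
  proof (rule flow_mono)
    fix a assume "a \<in> A I"
    then show "?h (fst a) + of_bool (head a = Pick i)
      \<le> ?h (snd a) + of_bool (tail a \<notin> S \<and> head a \<in> S)"
      using assms by (cases rule: arc_cases) (auto simp: tail_def)
  qed
  then show ?thesis
    using flow_conservation[of ?h] flow_into_Pick[OF assms(1)] by (simp add: flow_add)
qed

section \<open>The projected point and the LB constraints\<close>

definition xbar :: "loc \<Rightarrow> loc \<Rightarrow> real" where
  "xbar i j = flow (\<lambda>a. of_bool (tail a = i \<and> head a = j))"

text \<open>The inflow of a pick-up or delivery is 1, so this is a weighted average of event loads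
  there; at both depot copies it is 0.\<close>

definition mean_load :: "loc \<Rightarrow> real" where
  "mean_load j = flow (\<lambda>a. of_bool (head a = j) * load I (snd a))"

text \<open>Exchanging the sums turns sums of routing variables back into flows: weights 1 serve the
  degree, vehicle and precedence constraints, routing costs the objective.\<close>

lemma sum_xbar:
  assumes "finite S" "finite T"
  shows "(\<Sum>i\<in>S. \<Sum>j\<in>T. c i j * xbar i j) = flow (\<lambda>a. of_bool (tail a \<in> S \<and> head a \<in> T) * c (tail a) (head a))"
  unfolding xbar_def flow_scale[symmetric] flow_sum[symmetric]
  using assms by (simp only: sum_of_bool_pair)

lemma xbar_nonneg: "0 \<le> xbar i j"
  unfolding xbar_def flow_def by (auto intro!: sum_nonneg mult_nonneg_nonneg x_nonneg)

lemma xbar_Sink: "xbar Sink j = 0"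
  unfolding xbar_def by (rule flow_eq_0) (auto dest: head_tail_Jbar)

lemma xbar_Source: "xbar i Source = 0"
  unfolding xbar_def by (rule flow_eq_0) (auto dest: head_tail_Jbar)

lemma xbar_in:
  assumes "j \<in> pickups I \<union> dropoffs I"
  shows "(\<Sum>i\<in>Jbar I. xbar i j) = 1"
proof -
  have "(\<Sum>i\<in>Jbar I. xbar i j) = flow (\<lambda>a. of_bool (tail a \<in> Jbar I \<and> head a \<in> {j}))"
    using sum_xbar[of "Jbar I" "{j}" "\<lambda>_ _. 1"] by simp
  also have "\<dots> = flow (\<lambda>a. of_bool (head a = j))"
    by (rule flow_cong) (use head_tail_Jbar in auto)
  finally show ?thesis using flow_in[OF assms] by simp
qed

lemma xbar_out:
  assumes "i \<in> pickups I \<union> dropoffs I"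
  shows "(\<Sum>j\<in>Jbar I. xbar i j) = 1"
proof -
  have "(\<Sum>j\<in>Jbar I. xbar i j) = flow (\<lambda>a. of_bool (tail a \<in> {i} \<and> head a \<in> Jbar I))"
    using sum_xbar[of "{i}" "Jbar I" "\<lambda>_ _. 1"] by simp
  also have "\<dots> = flow (\<lambda>a. of_bool (tail a = i))"
    by (rule flow_cong) (use head_tail_Jbar in auto)
  finally show ?thesis using flow_out[OF assms] by simp
qed

text \<open>No degree equation bounds this entry, so the upper bound 1 needs a separate argument:
  only arcs of \<open>A6\<close> leave the depot, and they lead to a pick-up.\<close>

lemma xbar_Depot_Depot: "xbar Source Sink = 0"
  unfolding xbar_def
proof (rule flow_eq_0)
  fix a assume a: "a \<in> A I"
  then have "a \<notin> A6 I \<Longrightarrow> fst (fst a) \<noteq> Depot" "a \<in> A6 I \<Longrightarrow> fst (snd a) \<noteq> Depot"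
    by (auto simp: A_def A1_def A2_def A3_def A4_def A5_def A6_def)
  moreover have "tail a = Source \<Longrightarrow> fst (fst a) = Depot" "head a = Sink \<Longrightarrow> fst (snd a) = Depot"
    using head_tail_eq[OF a] by simp_all
  ultimately have "\<not> (tail a = Source \<and> head a = Sink)" by blast
  then show "of_bool (tail a = Source \<and> head a = Sink) = (0::real)" by simp
qed

lemma xbar_le_1:
  assumes "i \<in> Jbar I" "j \<in> Jbar I"
  shows "xbar i j \<le> 1"
proof -
  consider "i \<in> pickups I \<union> dropoffs I" | "j \<in> pickups I \<union> dropoffs I" | "i = Sink" | "j = Source"
    | "i = Source" "j = Sink"
    using assms by (auto simp: Jbar_def)
  then show ?thesis
  proof cases
    case 1
    have "xbar i j \<le> flow (\<lambda>a. of_bool (tail a = i))"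
      unfolding xbar_def by (rule flow_mono) auto
    then show ?thesis using flow_out[OF 1] by simp
  next
    case 2
    have "xbar i j \<le> flow (\<lambda>a. of_bool (head a = j))"
      unfolding xbar_def by (rule flow_mono) auto
    then show ?thesis using flow_in[OF 2] by simp
  qed (simp_all add: xbar_Sink xbar_Source xbar_Depot_Depot)
qed

lemma xbar_vehicles: "(\<Sum>j\<in>pickups I. xbar Source j) \<le> real (vehicles I)"
proof -
  have "finite (pickups I)" by (simp add: pickups_def requests_def)
  then have "(\<Sum>j\<in>pickups I. xbar Source j) = flow (\<lambda>a. of_bool (tail a \<in> {Source} \<and> head a \<in> pickups I))"
    using sum_xbar[of "{Source}" "pickups I" "\<lambda>_ _. 1"] by simp
  also have "\<dots> \<le> flow (\<lambda>a. of_bool (fst a = zero_event I))"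
  proof (rule flow_mono)
    fix a assume "a \<in> A I"
    with arc_V have "fst a \<in> V I" by blast
    then have "tail a = Source \<Longrightarrow> fst a = zero_event I"
      by (cases rule: fst_V) (auto simp: tail_def as_source_def)
    then show "of_bool (tail a \<in> {Source} \<and> head a \<in> pickups I) \<le> (of_bool (fst a = zero_event I) :: real)"
      by auto
  qed
  also have "\<dots> = (\<Sum>a\<in>out_arcs I (zero_event I). x a)"
    by (simp add: flow_of_bool out_arcs_def)
  also have "\<dots> \<le> real (vehicles I)"
    using feasible by (simp add: LAEB_feasible_def)
  finally show ?thesis .
qed

text \<open>Every location of \<open>S\<close> except \<open>Source\<close> has inflow 1, and
  \<open>Source\<close> has none, so \<open>card S - 1\<close> units end in \<open>S\<close>. By
  \<open>flow_cut\<close> at least one of them starts outside.\<close>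

lemma xbar_precedence:
  assumes "S \<in> prec_sets I"
  shows "(\<Sum>i\<in>S. \<Sum>j\<in>S. xbar i j) \<le> real (card S) - 2"
proof -
  obtain i where i: "i \<in> requests I" "Pick i \<notin> S" "Drop i \<in> S"
    and S: "S \<subseteq> Jbar I" "Source \<in> S" "Sink \<notin> S"
    using assms by (auto simp: prec_sets_def)
  have fin: "finite S" using S finite_subset finite_Jbar by blast
  have "flow (\<lambda>a. of_bool (head a \<in> S)) = flow (\<lambda>a. \<Sum>j\<in>S - {Source}. of_bool (head a = j))"
  proof (rule flow_cong)
    fix a assume "a \<in> A I"
    then have "head a \<noteq> Source" using head_tail_Jbar by blast
    moreover have "(\<Sum>j\<in>S - {Source}. of_bool (head a = j)) =
      (\<Sum>j\<in>S - {Source}. if head a = j then 1 else 0 :: real)"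
      by (intro sum.cong) auto
    ultimately show "of_bool (head a \<in> S) = (\<Sum>j\<in>S - {Source}. of_bool (head a = j) :: real)"
      using fin by simp
  qed
  also have "\<dots> = (\<Sum>j\<in>S - {Source}. flow (\<lambda>a. of_bool (head a = j)))"
    by (rule flow_sum)
  also have "\<dots> = (\<Sum>j\<in>S - {Source}. 1)"
  proof (intro sum.cong refl flow_in)
    fix j assume "j \<in> S - {Source}"
    then show "j \<in> pickups I \<union> dropoffs I" using S by (auto simp: Jbar_def)
  qed
  also have "\<dots> = real (card S) - 1"
  proof -
    have "Suc (card (S - {Source})) = card S" using fin S(2) by (rule card_Suc_Diff1)
    then show ?thesis by simp
  qed
  finally have in_S: "flow (\<lambda>a. of_bool (head a \<in> S)) = real (card S) - 1" .
  have "(\<Sum>i\<in>S. \<Sum>j\<in>S. xbar i j) = flow (\<lambda>a. of_bool (tail a \<in> S \<and> head a \<in> S))"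
    using sum_xbar[OF fin fin, of "\<lambda>_ _. 1"] by simp
  also have "\<dots> = flow (\<lambda>a. of_bool (head a \<in> S) - of_bool (tail a \<notin> S \<and> head a \<in> S))"
    by (rule flow_cong) auto
  also have "\<dots> = real (card S) - 1 - flow (\<lambda>a. of_bool (tail a \<notin> S \<and> head a \<in> S))"
    by (simp add: flow_diff in_S)
  also have "\<dots> \<le> real (card S) - 2" using flow_cut[OF i] by simp
  finally show ?thesis .
qed

lemma xbar_time:
  assumes "i \<in> Jbar I" "j \<in> Jbar I"
  shows "B i + service_at I i + travel I i j - bigM I i j * (1 - xbar i j) \<le> B j"
proof (cases "i = Sink \<or> j = Source")
  case True
  \<comment> \<open>These pairs have no counterpart in LAEB. No arc uses them, and the lower bound
    on \<open>bigM\<close> makes their constraint hold for all times within the windows.\<close>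
  have "bigM I i j \<ge> latest I i + service_at I i + travel I i j - earliest I j"
    using inst assms by (simp add: darp_instance_def)
  moreover have "B i \<le> latest I i" "earliest I j \<le> B j"
    using feasible assms by (auto simp: LAEB_feasible_def)
  moreover have "xbar i j = 0" using True xbar_Sink xbar_Source by auto
  ultimately show ?thesis by simp
next
  case False
  let ?i = "base i" and ?j = "base j"
  have base: "?i \<in> J I" "?j \<in> J I"
    using False assms by (auto simp: Jbar_def J_def pickups_def dropoffs_def)
  have copies: "as_source ?i = i" "as_sink ?j = j"
    using as_source_eq[OF base(1) assms(1)] as_sink_eq[OF base(2) assms(2)] False by simp_all
  have "fst (fst a) = ?i \<and> fst (snd a) = ?j \<longleftrightarrow> tail a = i \<and> head a = j" if "a \<in> A I" for a
    using as_source_eq[OF fst_V_J assms(1)] as_sink_eq[OF fst_V_J assms(2)] arc_V[OF that] False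
    by (simp add: tail_def head_def)
  then have "a \<in> {(v, w) \<in> A I. fst v = ?i \<and> fst w = ?j} \<longleftrightarrow>
      a \<in> {a \<in> A I. tail a = i \<and> head a = j}" for a
    by (simp only: mem_Collect_eq case_prod_beta prod.collapse) blast
  then have arcs: "{(v, w) \<in> A I. fst v = ?i \<and> fst w = ?j} = {a \<in> A I. tail a = i \<and> head a = j}"
    by (rule set_eqI)
  have "\<forall>i\<in>J I. \<forall>j\<in>J I.
        B (as_sink j) \<ge> B (as_source i) + service_at I i + travel I i j
          - bigM I (as_source i) (as_sink j)
            * (1 - (\<Sum>a\<in>{(v, w) \<in> A I. fst v = i \<and> fst w = j}. x a))"
    using feasible by (simp add: LAEB_feasible_def)
  from bspec[OF bspec[OF this base(1)] base(2)]
  have "B j \<ge> B i + service_at I ?i + travel I ?i ?j - bigM I i j * (1 - xbar i j)"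
    unfolding copies arcs xbar_def flow_of_bool .
  moreover have "service_at I ?i = service_at I i"
    by (cases i) (auto simp: service_at_def)
  moreover have "travel I ?i ?j = travel I i j"
    by (cases i; cases j) (auto simp: travel_def)
  ultimately show ?thesis by simp
qed

lemma mean_load_depot: "mean_load Source = 0" "mean_load Sink = 0"
proof -
  show "mean_load Source = 0"
    unfolding mean_load_def by (rule flow_eq_0) (auto dest: head_tail_Jbar)
  show "mean_load Sink = 0"
    unfolding mean_load_def
  proof (rule flow_eq_0)
    fix a assume "a \<in> A I"
    with arc_V have "snd a \<in> V I" by blast
    then show "of_bool (head a = Sink) * load I (snd a) = 0"
      by (cases rule: fst_V) (auto simp: head_def as_sink_def)
  qed
qed

lemma mean_load_bounds:
  assumes "j \<in> Jbar I"
  shows "max 0 (load_change I j) \<le> mean_load j"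
    "mean_load j \<le> min (real (capacity I)) (real (capacity I) + load_change I j)"
proof -
  let ?l = "max 0 (load_change I j)"
  let ?u = "min (real (capacity I)) (real (capacity I) + load_change I j)"
  have "?l \<le> mean_load j \<and> mean_load j \<le> ?u"
  proof (cases "j \<in> pickups I \<union> dropoffs I")
    case True
    have b: "head a = j \<Longrightarrow> ?l \<le> load I (snd a) \<and> load I (snd a) \<le> ?u" if "a \<in> A I" for a
      using load_bounds[OF inst, of "snd a"] arc_V[OF that] by (simp add: head_def)
    have "?l = flow (\<lambda>a. ?l * of_bool (head a = j))"
      using flow_in[OF True] by (simp add: flow_scale)
    also have "\<dots> \<le> mean_load j"
      unfolding mean_load_def by (rule flow_mono) (use b in auto)
    finally have "?l \<le> mean_load j" .
    moreover have "mean_load j \<le> flow (\<lambda>a. ?u * of_bool (head a = j))"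
      unfolding mean_load_def by (rule flow_mono) (use b in auto)
    then have "mean_load j \<le> ?u" using flow_in[OF True] by (simp add: flow_scale)
    ultimately show ?thesis by blast
  next
    case False
    then have "j = Source \<or> j = Sink" using assms by (auto simp: Jbar_def)
    then show ?thesis using mean_load_depot load_change_simps[OF inst] by auto
  qed
  then show "?l \<le> mean_load j" "mean_load j \<le> ?u" by blast+
qed

text \<open>
  Both loads are split into the part along arcs from \<open>i\<close> to \<open>j\<close>, where the loads differ by
  exactly \<^term>\<open>load_change I j\<close>, and the remaining part of weight \<^term>\<open>1 - xbar i j\<close>, which is
  estimated by the load bounds.
\<close>

lemma mean_load_step:
  assumes "i \<in> Jbar I" "j \<in> Jbar I"
  shows "mean_load i + load_change I j - real (capacity I) * (1 - xbar i j) \<le> mean_load j"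
proof (cases "i \<in> pickups I \<union> dropoffs I")
  case False
  \<comment> \<open>Starting from load 0, the lower bound on \<open>mean_load j\<close> already
    suffices.\<close>
  then have "mean_load i = 0" using assms mean_load_depot by (auto simp: Jbar_def)
  moreover have "real (capacity I) * (1 - xbar i j) \<ge> 0" using xbar_le_1[OF assms] by simp
  ultimately show ?thesis using mean_load_bounds(1)[OF assms(2)] by simp
next
  case True
  let ?Q = "real (capacity I)" and ?c = "load_change I j"
  define Y where "Y = flow (\<lambda>a. of_bool (tail a = i \<and> head a = j) * load I (fst a))"
  have Q: "load I (fst a) \<le> ?Q" if "a \<in> A I" for a
    using load_bounds(2)[OF inst, of "fst a"] arc_V[OF that] by simp
  have "mean_load i = flow (\<lambda>a. of_bool (tail a = i) * load I (fst a))"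
    unfolding mean_load_def using flow_tail_eq_head[OF True] by simp
  also have "\<dots> \<le> flow (\<lambda>a. of_bool (tail a = i \<and> head a = j) * load I (fst a) +
      ?Q * (of_bool (tail a = i) - of_bool (tail a = i \<and> head a = j)))"
    by (rule flow_mono) (use Q in auto)
  also have "\<dots> = Y + ?Q * (1 - xbar i j)"
    by (simp only: flow_add flow_scale flow_diff flow_out[OF True] Y_def xbar_def)
  finally have i: "mean_load i \<le> Y + ?Q * (1 - xbar i j)" .
  have "Y + ?c \<le> mean_load j"
  proof (cases "j \<in> pickups I \<union> dropoffs I")
    case j: True
    \<comment> \<open>The change \<open>?c\<close> is charged on the whole inflow of
      \<open>j\<close>, which is 1, and not only on arcs from \<open>i\<close>. Arcs from elsewhere
      can pay for it because the load before the change is non-negative.\<close>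
    have "Y + ?c = flow (\<lambda>a. of_bool (tail a = i \<and> head a = j) * load I (fst a) + ?c * of_bool (head a = j))"
      by (simp only: flow_add flow_scale flow_in[OF j] Y_def)
    also have "\<dots> \<le> mean_load j"
      unfolding mean_load_def
    proof (rule flow_mono)
      fix a assume a: "a \<in> A I"
      show "of_bool (tail a = i \<and> head a = j) * load I (fst a) + ?c * of_bool (head a = j)
        \<le> of_bool (head a = j) * load I (snd a)"
        using load_arc[OF inst a] load_nonneg[of I "fst a"] by (auto simp: head_def)
    qed
    finally show ?thesis .
  next
    case j: False
    \<comment> \<open>The inflow of a depot copy need not be 1, but nothing has to be normalised
      when the load change is 0.\<close>
    then have c: "?c = 0" using assms load_change_simps[OF inst] by (auto simp: Jbar_def)
    have "Y \<le> mean_load j"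
      unfolding mean_load_def Y_def
    proof (rule flow_mono)
      fix a assume a: "a \<in> A I"
      show "of_bool (tail a = i \<and> head a = j) * load I (fst a) \<le> of_bool (head a = j) * load I (snd a)"
        using load_arc[OF inst a] load_nonneg[of I "snd a"] c by (auto simp: head_def)
    qed
    then show ?thesis by (simp add: c)
  qed
  with i show ?thesis by simp
qed

lemma LB_point: "(xbar, B, mean_load) \<in> LB_feasible I {0..1}"
proof -
  have "\<forall>j\<in>Jbar I. earliest I j \<le> B j \<and> B j \<le> latest I j"
    "\<forall>i\<in>requests I. B (Drop i) - B (Pick i) - service I i \<le> max_ride I i"
    using feasible by (auto simp: LAEB_feasible_def)
  then show ?thesis
    unfolding LB_feasible_def
    by (simp only: mem_Collect_eq prod.case atLeastAtMost_iff)
      (intro conjI ballI; blast intro: xbar_in xbar_out xbar_vehicles xbar_precedence xbar_time mean_load_step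
        mean_load_bounds xbar_nonneg xbar_le_1)
qed

lemma LB_objective_point: "LB_objective I (xbar, B, mean_load) = LAEB_objective I (x, B)"
proof -
  have "LB_objective I (xbar, B, mean_load) =
    flow (\<lambda>a. of_bool (tail a \<in> Jbar I \<and> head a \<in> Jbar I) * cost I (tail a) (head a))"
    by (simp add: LB_objective_def sum_xbar)
  also have "\<dots> = flow (\<lambda>a. cost I (fst (fst a)) (fst (snd a)))"
    by (rule flow_cong)
      (use head_tail_Jbar in \<open>auto simp: cost_def tail_def head_def as_source_def as_sink_def\<close>)
  also have "\<dots> = LAEB_objective I (x, B)"
    by (simp add: flow_def LAEB_objective_def case_prod_beta mult.commute)
  finally show ?thesis .
qed

end

section \<open>Existence of LB optima\<close>

text \<open>Tychonoff's theorem. The variables are functions on the infinite type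
  \<open>loc\<close>, so compactness is taken in the product topology.\<close>

lemma compact_PiE_UNIV:
  fixes K :: "'a \<Rightarrow> 'b::topological_space set"
  assumes "\<And>i. compact (K i)"
  shows "compact (PiE UNIV K)"
proof -
  have "compactin (product_topology (\<lambda>i::'a. euclidean :: 'b topology) UNIV) (PiE UNIV K)"
    using assms by (simp add: compactin_PiE)
  then show ?thesis by (simp add: euclidean_product_topology)
qed

lemma closed_Collect_ball:
  assumes "\<And>i. i \<in> S \<Longrightarrow> closed {p. P i p}"
  shows "closed {p. \<forall>i\<in>S. P i p}"
  unfolding Collect_ball_eq using assms by (rule closed_INT[rule_format])

lemma continuous_on_LB_variables:
  fixes i j :: loc
  shows "continuous_on S (\<lambda>p::(loc \<Rightarrow> loc \<Rightarrow> real) \<times> (loc \<Rightarrow> real) \<times> (loc \<Rightarrow> real). fst p i j)"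
    "continuous_on S (\<lambda>p::(loc \<Rightarrow> loc \<Rightarrow> real) \<times> (loc \<Rightarrow> real) \<times> (loc \<Rightarrow> real). fst (snd p) j)"
    "continuous_on S (\<lambda>p::(loc \<Rightarrow> loc \<Rightarrow> real) \<times> (loc \<Rightarrow> real) \<times> (loc \<Rightarrow> real). snd (snd p) j)"
  by (rule continuous_on_product_then_coordinatewise[OF
        continuous_on_product_then_coordinatewise[OF continuous_on_fst[OF continuous_on_id]]],
      rule continuous_on_product_then_coordinatewise[OF
        continuous_on_fst[OF continuous_on_snd[OF continuous_on_id]]],
      rule continuous_on_product_then_coordinatewise[OF
        continuous_on_snd[OF continuous_on_snd[OF continuous_on_id]]])

lemma closed_LB_feasible: "closed (LB_feasible I {0..1})"
  unfolding LB_feasible_def case_prod_beta atLeastAtMost_iff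
  by (intro closed_Collect_conj closed_Collect_ball closed_Collect_le closed_Collect_eq
      continuous_intros continuous_on_LB_variables)

lemma continuous_on_LB_objective: "continuous_on S (LB_objective I)"
  unfolding LB_objective_def case_prod_beta
  by (intro continuous_intros continuous_on_LB_variables)

text \<open>Values outside \<open>Jbar I\<close> are unconstrained and keep the feasible set from
  being compact. They affect neither feasibility nor cost, so they may be replaced.\<close>

lemma LB_feasible_restrict:
  assumes "(x, B, L) \<in> LB_feasible I X"
    and x: "\<And>i j. i \<in> Jbar I \<Longrightarrow> j \<in> Jbar I \<Longrightarrow> x' i j = x i j"
    and B: "\<And>j. j \<in> Jbar I \<Longrightarrow> B' j = B j" and L: "\<And>j. j \<in> Jbar I \<Longrightarrow> L' j = L j"
  shows "(x', B', L') \<in> LB_feasible I X" "LB_objective I (x', B', L') = LB_objective I (x, B, L)"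
proof -
  have sub: "pickups I \<subseteq> Jbar I" "dropoffs I \<subseteq> Jbar I" "Source \<in> Jbar I"
    by (auto simp: Jbar_def)
  have req: "Pick i \<in> Jbar I" "Drop i \<in> Jbar I" if "i \<in> requests I" for i
    using that by (auto simp: Jbar_def pickups_def dropoffs_def)
  have "(\<Sum>j\<in>pickups I. x' Source j) = (\<Sum>j\<in>pickups I. x Source j)"
    using sub x by (intro sum.cong) auto
  moreover have "(\<Sum>i\<in>Jbar I. x' i j) = (\<Sum>i\<in>Jbar I. x i j)"
    "(\<Sum>i\<in>Jbar I. x' j i) = (\<Sum>i\<in>Jbar I. x j i)" if "j \<in> pickups I \<union> dropoffs I" for j
    using that sub x by (intro sum.cong; blast)+
  moreover have "(\<Sum>i\<in>S. \<Sum>j\<in>S. x' i j) = (\<Sum>i\<in>S. \<Sum>j\<in>S. x i j)" if "S \<in> prec_sets I" for S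
    using that x by (intro sum.cong) (auto simp: prec_sets_def)
  ultimately show "(x', B', L') \<in> LB_feasible I X"
    using assms(1) by (simp add: LB_feasible_def x B L req)
  show "LB_objective I (x', B', L') = LB_objective I (x, B, L)"
    by (simp add: LB_objective_def x)
qed

lemma LB_optimum_exists:
  assumes "LB_feasible I {0..1} \<noteq> {}"
  shows "\<exists>p. is_arg_min (LB_objective I) (\<lambda>p. p \<in> LB_feasible I {0..1}) p"
proof -
  let ?F = "LB_feasible I {0..1}"
  \<comment> \<open>This box contains every feasible point whose values outside
    \<open>Jbar I\<close> have been set to 0. The intervals on \<open>Jbar I\<close> come from the
    constraints; elsewhere a time window need not contain 0, hence \<open>{0}\<close>.\<close>
  define C :: "((loc \<Rightarrow> loc \<Rightarrow> real) \<times> (loc \<Rightarrow> real) \<times> (loc \<Rightarrow> real)) set" where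
    "C = (UNIV \<rightarrow>\<^sub>E (UNIV \<rightarrow>\<^sub>E {0..1})) \<times>
      (\<Pi>\<^sub>E j\<in>UNIV. if j \<in> Jbar I then {earliest I j..latest I j} else {0}) \<times>
      (UNIV \<rightarrow>\<^sub>E {0..real (capacity I)})"
  have "compact C"
    unfolding C_def by (intro compact_Times compact_PiE_UNIV) auto
  then have compact: "compact (?F \<inter> C)"
    by (rule closed_Int_compact[OF closed_LB_feasible])
  have clip: "\<exists>p'\<in>?F \<inter> C. LB_objective I p' = LB_objective I p" if "p \<in> ?F" for p
  proof -
    obtain x B L where p: "p = (x, B, L)" by (cases p)
    define x' where "x' = (\<lambda>i j. if i \<in> Jbar I \<and> j \<in> Jbar I then x i j else 0)"
    define B' where "B' = (\<lambda>j. if j \<in> Jbar I then B j else 0)"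
    define L' where "L' = (\<lambda>j. if j \<in> Jbar I then L j else 0)"
    have "(x', B', L') \<in> ?F \<and> LB_objective I (x', B', L') = LB_objective I p"
      using LB_feasible_restrict[OF that[unfolded p], of x' B' L'] p
      by (simp add: x'_def B'_def L'_def)
    moreover have "(x', B', L') \<in> C"
      using that by (auto simp: C_def p LB_feasible_def x'_def B'_def L'_def)
    ultimately show ?thesis by blast
  qed
  then have "?F \<inter> C \<noteq> {}" using assms by blast
  from continuous_attains_inf[OF compact this continuous_on_LB_objective]
  obtain p where "p \<in> ?F \<inter> C" and "\<forall>q\<in>?F \<inter> C. LB_objective I p \<le> LB_objective I q"
    by blast
  then have "is_arg_min (LB_objective I) (\<lambda>p. p \<in> ?F) p"
    unfolding is_arg_min_linorder using clip by (metis IntD1)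
  then show ?thesis ..
qed

section \<open>Comparison of the optimal values\<close>

lemma opt_value_eq:
  assumes "is_arg_min f (\<lambda>x. x \<in> X) x"
  shows "opt_value X f = ereal (f x)"
proof -
  have "is_arg_min f (\<lambda>x. x \<in> X) (ARG_MIN f x. x \<in> X)"
    unfolding arg_min_def using assms by (rule someI)
  then have "f (ARG_MIN f x. x \<in> X) = f x"
    using assms by (auto simp: is_arg_min_linorder intro: antisym)
  then show ?thesis using assms by (auto simp: opt_value_def)
qed

lemma Z_LB_rel_le:
  assumes "p \<in> LB_feasible I {0..1}"
  shows "Z_LB_rel I \<le> ereal (LB_objective I p)"
proof -
  obtain q where q: "is_arg_min (LB_objective I) (\<lambda>p. p \<in> LB_feasible I {0..1}) q"
    using LB_optimum_exists assms by blast
  then show ?thesis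
    using assms by (auto simp: Z_LB_rel_def opt_value_eq[OF q] is_arg_min_linorder simp del: split_paired_All)
qed

lemma Z_LB_rel_le_Z_LAEB_rel:
  assumes "darp_instance I"
  shows "Z_LB_rel I \<le> Z_LAEB_rel I"
proof (cases "\<exists>p. is_arg_min (LAEB_objective I) (\<lambda>p. p \<in> LAEB_feasible I {0..1}) p")
  case True
  then obtain x B where opt: "is_arg_min (LAEB_objective I) (\<lambda>p. p \<in> LAEB_feasible I {0..1}) (x, B)"
    by auto
  interpret LAEB_point I x B
    using assms opt by unfold_locales (auto simp: is_arg_min_linorder)
  show ?thesis
    using Z_LB_rel_le[OF LB_point] LB_objective_point by (simp add: Z_LAEB_rel_def opt_value_eq[OF opt])
next
  case False
  then show ?thesis by (simp add: Z_LAEB_rel_def opt_value_def)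
qed

section \<open>An instance with a strict inequality\<close>

text \<open>
  One request, one vehicle, unit capacity, and unit cost between the depot and the two locations
  of the request. The event graph is a cycle of cost 2, on which the flow is forced to be 1. In
  the LB relaxation only half a vehicle leaves the depot, and the remaining half unit of flow runs
  around the subtour between the pick-up and the delivery, which the big-M constraints admit.
\<close>

definition gap_instance :: darp where
  "gap_instance = \<lparr> num_req = 1, persons = (\<lambda>r. if r = 1 then 1 else 0),
     service = (\<lambda>r. if r = 1 then 1 else 0), max_ride = (\<lambda>_. 2), capacity = 1, vehicles = 1,
     travel0 = (\<lambda>_ _. 0), cost0 = (\<lambda>i j. if i = Depot \<longleftrightarrow> j = Depot then 0 else 1),
     earliest0 = (\<lambda>_. 0), latest0 = (\<lambda>_. 10), duration = 10, bigM = (\<lambda>_ _. 100) \<rparr>"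

lemma gap_sets:
  "requests gap_instance = {1}" "pickups gap_instance = {Pick 1}" "dropoffs gap_instance = {Drop 1}"
  "J gap_instance = {Pick 1, Drop 1, Depot}"
  "Jbar gap_instance = {Pick 1, Drop 1, Source, Sink}"
  by (auto simp: requests_def pickups_def dropoffs_def J_def Jbar_def gap_instance_def)

lemma gap_data:
  "travel gap_instance i j = 0" "earliest gap_instance j = 0" "latest gap_instance j = 10"
  "service_at gap_instance j = (if req_of j = 1 then 1 else 0)"
  "persons_at gap_instance j = (if req_of j = 1 then 1 else 0)"
  "cost gap_instance i j = (if base i = Depot \<longleftrightarrow> base j = Depot then 0 else 1)"
  "bigM gap_instance i j = 100" "capacity gap_instance = 1" "vehicles gap_instance = 1"
  "max_ride gap_instance r = 2" "service gap_instance r = (if r = 1 then 1 else 0)"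
  "persons gap_instance r = (if r = 1 then 1 else 0)" "duration gap_instance = 10"
  by (simp_all add: travel_def earliest_def latest_def service_at_def persons_at_def cost_def
      gap_instance_def)

text \<open>With zero travel times, service time 1 makes the direct ride positive and shorter than
  2. The constant 100 exceeds the required 10 + 1 + 0 - 0. Cost is charged only between depot and
  request, which respects the triangle inequality and makes the subtour free.\<close>

lemma darp_instance_gap: "darp_instance gap_instance"
  by (simp add: darp_instance_def gap_sets gap_data)

abbreviation "gap_depot \<equiv> (Depot, [] :: nat list)"
abbreviation "gap_pick \<equiv> (Pick 1, [] :: nat list)"
abbreviation "gap_drop \<equiv> (Drop 1, [] :: nat list)"

lemma gap_zero_event: "zero_event gap_instance = gap_depot"
  by (simp add: zero_event_def gap_data)

lemma gap_V_pick: "V_pick gap_instance 1 = {gap_pick}"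
  by (auto simp: V_pick_def valid_tuple_def gap_data persons_at_def)

lemma gap_V_drop: "V_drop gap_instance 1 = {gap_drop}"
  by (auto simp: V_drop_def valid_tuple_def gap_data persons_at_def)

lemma gap_V: "V gap_instance = {gap_depot, gap_pick, gap_drop}"
  unfolding V_def gap_sets UN_insert gap_V_pick gap_V_drop gap_zero_event by auto

text \<open>Capacity 1 excludes \<open>A2\<close> and \<open>A4\<close>, a single request excludes
  \<open>A3\<close>, and one directed cycle is left.\<close>

lemma gap_A:
  "A gap_instance = {(gap_depot, gap_pick), (gap_pick, gap_drop), (gap_drop, gap_depot)}"
proof -
  have "A1 gap_instance = {(gap_pick, gap_drop)}"
    unfolding A1_def gap_V gap_sets by auto
  moreover have "A2 gap_instance = {}" "A4 gap_instance = {}"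
    unfolding A2_def A4_def by (auto simp: gap_data)
  moreover have "A3 gap_instance = {}"
    unfolding A3_def gap_sets by auto
  moreover have "A5 gap_instance = {(gap_drop, gap_depot)}"
    unfolding A5_def gap_V gap_sets gap_zero_event by (auto simp: gap_data)
  moreover have "A6 gap_instance = {(gap_depot, gap_pick)}"
    unfolding A6_def gap_V gap_sets gap_zero_event by (auto simp: gap_data)
  ultimately show ?thesis unfolding A_def by auto
qed

lemma gap_arcs:
  "in_arcs gap_instance gap_depot = {(gap_drop, gap_depot)}"
  "in_arcs gap_instance gap_pick = {(gap_depot, gap_pick)}"
  "in_arcs gap_instance gap_drop = {(gap_pick, gap_drop)}"
  "out_arcs gap_instance gap_depot = {(gap_depot, gap_pick)}"
  "out_arcs gap_instance gap_pick = {(gap_pick, gap_drop)}"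
  "out_arcs gap_instance gap_drop = {(gap_drop, gap_depot)}"
  by (auto simp: in_arcs_def out_arcs_def gap_A)

text \<open>The pick-up equation fixes one arc at 1 and conservation carries this value round the
  cycle. The two depot arcs cost 1 each, the ride costs nothing.\<close>

lemma gap_LAEB_objective:
  assumes "p \<in> LAEB_feasible gap_instance {0..1}"
  shows "LAEB_objective gap_instance p = 2"
proof -
  obtain x B where p: "p = (x, B)" by (cases p)
  have cons: "\<forall>v\<in>V gap_instance. (\<Sum>a\<in>in_arcs gap_instance v. x a) - (\<Sum>a\<in>out_arcs gap_instance v. x a) = 0"
    and one: "\<forall>i\<in>requests gap_instance. (\<Sum>v\<in>V_pick gap_instance i. \<Sum>a\<in>in_arcs gap_instance v. x a) = 1"
    using assms by (simp_all add: p LAEB_feasible_def)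
  have singleton: "(\<Sum>b\<in>{a}. y b) = y a" for y :: "'a \<Rightarrow> real" and a
    by simp
  have "(\<Sum>v\<in>V_pick gap_instance 1. \<Sum>a\<in>in_arcs gap_instance v. x a) = 1"
    using one unfolding gap_sets by blast
  then have pick: "x (gap_depot, gap_pick) = 1"
    unfolding gap_V_pick singleton gap_arcs .
  have "gap_depot \<in> V gap_instance" "gap_pick \<in> V gap_instance" unfolding gap_V by blast+
  from this[THEN bspec[OF cons]]
  have "x (gap_drop, gap_depot) = 1" "x (gap_pick, gap_drop) = 1"
    unfolding gap_arcs singleton pick by linarith+
  with pick show ?thesis
    by (simp add: p LAEB_objective_def gap_A gap_data)
qed

text \<open>The times are the earliest schedule: leave and pick up at 0, then one unit of service at
  each of the two stops. A feasible point is what makes the LAEB value finite.\<close>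

lemma gap_LAEB_feasible:
  "(\<lambda>_. 1, \<lambda>j. if j = Drop 1 then 1 else if j = Sink then 2 else 0) \<in> LAEB_feasible gap_instance {0..1}"
proof -
  have arcs: "{(v, w) \<in> A gap_instance. fst v = i \<and> fst w = j} =
    (if i = Depot \<and> j = Pick 1 then {(gap_depot, gap_pick)}
     else if i = Pick 1 \<and> j = Drop 1 then {(gap_pick, gap_drop)}
     else if i = Drop 1 \<and> j = Depot then {(gap_drop, gap_depot)} else {})" for i j
    by (auto simp: gap_A)
  show ?thesis
    unfolding LAEB_feasible_def mem_Collect_eq prod.case arcs gap_sets gap_V gap_zero_event
    by (simp add: gap_V_pick[simplified] gap_arcs[simplified] gap_data as_source_def as_sink_def)
qed

text \<open>Precedence sets contain \<open>Source\<close>, so none cuts the subtour; the only one is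
  \<open>{Source, Drop 1}\<close>, within which nothing flows. On the half-used return arc the slack
  is 50 in time and 1/2 in load, enough for both constraints. Entering and leaving the depot costs
  1/2 each, 1 in total.\<close>

lemma gap_LB_feasible:
  "(\<lambda>i j. if i = Pick 1 \<and> j = Drop 1 then 1
      else if (i, j) \<in> {(Source, Pick 1), (Drop 1, Pick 1), (Drop 1, Sink)} then 1 / 2 else 0,
    \<lambda>j. if j = Drop 1 then 1 else 0, \<lambda>j. if j = Pick 1 then 1 else 0)
   \<in> LB_feasible gap_instance {0..1}"
proof -
  have "prec_sets gap_instance \<subseteq> {{Source, Drop 1}}"
    by (auto simp: prec_sets_def gap_sets)
  moreover have "{Source, Drop 1} \<in> prec_sets gap_instance"
    by (auto simp: prec_sets_def gap_sets)
  ultimately have prec: "prec_sets gap_instance = {{Source, Drop 1}}"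
    by blast
  show ?thesis
    unfolding LB_feasible_def mem_Collect_eq prod.case gap_sets prec
    by (simp add: gap_data gap_sets load_change_def)
qed

theorem theorem3:
  "(\<forall>I. darp_instance I \<longrightarrow> Z_LAEB_rel I \<ge> Z_LB_rel I) \<and>
   (\<exists>I. darp_instance I \<and> Z_LAEB_rel I > Z_LB_rel I \<and> Z_LAEB_rel I < \<infinity>)"
proof (intro conjI exI allI impI)
  show "Z_LB_rel I \<le> Z_LAEB_rel I" if "darp_instance I" for I
    using that by (rule Z_LB_rel_le_Z_LAEB_rel)
  show "darp_instance gap_instance" by (rule darp_instance_gap)
  obtain p where p: "p \<in> LAEB_feasible gap_instance {0..1}"
    using gap_LAEB_feasible by blast
  \<comment> \<open>The objective is constant on the feasible set, so every feasible point is a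
    minimiser.\<close>
  then have "is_arg_min (LAEB_objective gap_instance) (\<lambda>p. p \<in> LAEB_feasible gap_instance {0..1}) p"
    by (simp add: is_arg_min_linorder gap_LAEB_objective del: split_paired_All)
  then have LAEB: "Z_LAEB_rel gap_instance = 2"
    unfolding Z_LAEB_rel_def by (simp add: opt_value_eq gap_LAEB_objective[OF p])
  have "Z_LB_rel gap_instance \<le> ereal 1"
    by (rule Z_LB_rel_le[OF gap_LB_feasible, THEN order_trans])
      (simp add: LB_objective_def gap_sets gap_data)
  then show "Z_LB_rel gap_instance < Z_LAEB_rel gap_instance"
    unfolding LAEB by (rule order.strict_trans1) simp
  \<comment> \<open>Finiteness ensures that the gap does not merely reflect an infeasible LAEB
    relaxation.\<close>
  show "Z_LAEB_rel gap_instance < \<infinity>" unfolding LAEB by simp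
qed

end
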